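(* Let $\varepsilon>0$ be a constant (with $3/2-\varepsilon\ge 1$). Any (probabilistic bounded error or deterministic) symbolic algorithm that computes a $(3/2-\varepsilon)$-approximation of the diameter of an undirected connected graph with $n$ vertices needs $\Omega(n)$ symbolic one-step operations.
   Context: Symbolic model: the input is a finite graph $G=(V,E)$, $n=|V|$; an undirected graph is regarded as a directed graph with symmetric edge relation. The algorithm knows $V$, but it can access $E$ only through the one-step operations $\mathrm{Pre}(S)=\{v\in V\mid \exists s\in S:(v,s)\in E\}$ and $\mathrm{Post}(S)=\{v\in V\mid \exists s\in S:(s,v)\in E\}$ (equal for undirected graphs) applied to (adaptively chosen) sets $S\subseteq V$. All other computation, in particular basic set operations on vertex sets, is unrestricted and not counted in lower bounds; any number of sets may be stored. A probabilistic bounded error algorithm may use random bits and must be correct with probability at least $2/3$ on every input. The diameter $D$ of $G$ is the maximum of the distance $d(u,v)$ over all pairs $u,v$ such that $u$ can reach $v$. A $c$-approximation of the diameter is an estimate $\widetilde D$ with $D/c\le\widetilde D\le D$. Convention for lower bounds: "needs $\Omega(n)$ one-step operations" means: there is a constant $c'>0$ such that every (deterministic or probabilistic bounded error) symbolic algorithm solving the problem on all inputs performs, on inputs with arbitrarily large $n$, at least $c'\cdot n$ one-step operations (worst case over its random choices). *)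

theory Defs
  imports "HOL-Probability.Probability" "HOL-Library.Extended_Nat"
begin

section \<open>Graphs and the diameter\<close>

text \<open>
  Vertices are natural numbers; an undirected graph is a directed graph \<open>(V, E)\<close> with
  symmetric edge relation. Loops are excluded. Since this restricts both the inputs on which an
  algorithm has to be correct and the inputs that may witness a lower bound, a lower bound for
  loop-free graphs is also one for graphs that may have loops.
\<close>

definition connected_ugraph :: "nat set \<Rightarrow> nat rel \<Rightarrow> bool" where
  "connected_ugraph V E \<longleftrightarrow>
     finite V \<and> V \<noteq> {} \<and> E \<subseteq> V \<times> V \<and> sym E \<and> irrefl E \<and> (\<forall>u\<in>V. \<forall>v\<in>V. (u, v) \<in> E\<^sup>*)"

text \<open>The distance is only meaningful if \<open>u\<close> can reach \<open>v\<close>.\<close>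

definition gdist :: "nat rel \<Rightarrow> nat \<Rightarrow> nat \<Rightarrow> nat" where
  "gdist E u v = (LEAST k. (u, v) \<in> E ^^ k)"

definition gdiameter :: "nat set \<Rightarrow> nat rel \<Rightarrow> nat" where
  "gdiameter V E = Max {gdist E u v |u v. u \<in> V \<and> v \<in> V \<and> (u, v) \<in> E\<^sup>*}"

definition approximates_diameter :: "real \<Rightarrow> nat set \<Rightarrow> nat rel \<Rightarrow> real \<Rightarrow> bool" where
  "approximates_diameter c V E d \<longleftrightarrow> real (gdiameter V E) / c \<le> d \<and> d \<le> real (gdiameter V E)"


section \<open>Symbolic algorithms\<close>

definition pre_op :: "nat set \<Rightarrow> nat rel \<Rightarrow> nat set \<Rightarrow> nat set" where
  "pre_op V E S = {v \<in> V. \<exists>s\<in>S. (v, s) \<in> E}"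

definition post_op :: "nat set \<Rightarrow> nat rel \<Rightarrow> nat set \<Rightarrow> nat set" where
  "post_op V E S = {v \<in> V. \<exists>s\<in>S. (s, v) \<in> E}"

text \<open>
  An algorithm is given the vertex set and decides on its next action as an arbitrary function of
  everything it has observed so far. This makes all computation other than one-step operations
  free, and nothing observed is ever forgotten. Vertices outside \<open>V\<close> in the argument of an
  operation have no influence on its result, as \<open>E \<subseteq> V \<times> V\<close>, so arguments are not
  restricted to subsets of \<open>V\<close>.
\<close>

datatype action = Output real | Pre "nat set" | Post "nat set" | Coin

datatype observation = is_Result: Result "nat set" | Bit bool

type_synonym algorithm = "nat set \<Rightarrow> observation list \<Rightarrow> action"

text \<open>
  The observations after at most \<open>k\<close> steps; a coin flipped in step \<open>k\<close> shows \<open>\<omega> k\<close>.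
  The run stops (the transcript no longer changes) once an output is produced. It need not stop.
\<close>

primrec transcript ::
  "algorithm \<Rightarrow> nat set \<Rightarrow> nat rel \<Rightarrow> (nat \<Rightarrow> bool) \<Rightarrow> nat \<Rightarrow> observation list" where
  "transcript A V E \<omega> 0 = []"
| "transcript A V E \<omega> (Suc k) =
     (let h = transcript A V E \<omega> k in
      case A V h of
        Output d \<Rightarrow> h
      | Pre S \<Rightarrow> h @ [Result (pre_op V E S)]
      | Post S \<Rightarrow> h @ [Result (post_op V E S)]
      | Coin \<Rightarrow> h @ [Bit (\<omega> k)])"

definition outputs ::
  "algorithm \<Rightarrow> nat set \<Rightarrow> nat rel \<Rightarrow> (nat \<Rightarrow> bool) \<Rightarrow> real \<Rightarrow> bool" where
  "outputs A V E \<omega> d \<longleftrightarrow> (\<exists>k. A V (transcript A V E \<omega> k) = Output d)"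

text \<open>Coin flips are not counted; the number of operations is \<open>\<infinity>\<close> if it is unbounded.\<close>

definition num_ops :: "algorithm \<Rightarrow> nat set \<Rightarrow> nat rel \<Rightarrow> (nat \<Rightarrow> bool) \<Rightarrow> enat" where
  "num_ops A V E \<omega> = (SUP k. enat (length (filter is_Result (transcript A V E \<omega> k))))"

definition worst_case_ops :: "algorithm \<Rightarrow> nat set \<Rightarrow> nat rel \<Rightarrow> enat" where
  "worst_case_ops A V E = (SUP \<omega>. num_ops A V E \<omega>)"

definition coins :: "(nat \<Rightarrow> bool) measure" where
  "coins = (\<Pi>\<^sub>M i\<in>UNIV. measure_pmf (bernoulli_pmf (1/2)))"

definition deterministic :: "algorithm \<Rightarrow> bool" where
  "deterministic A \<longleftrightarrow> (\<forall>V h. A V h \<noteq> Coin)"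

definition det_diameter_approx :: "real \<Rightarrow> algorithm \<Rightarrow> bool" where
  "det_diameter_approx c A \<longleftrightarrow> deterministic A \<and>
     (\<forall>V E. connected_ugraph V E \<longrightarrow>
        (\<forall>\<omega>. \<exists>d. outputs A V E \<omega> d \<and> approximates_diameter c V E d))"

text \<open>
  The event below is measurable for every algorithm: whether a correct output has been produced
  within \<open>k\<close> steps depends on the first \<open>k\<close> bits only.
\<close>

definition prob_diameter_approx :: "real \<Rightarrow> algorithm \<Rightarrow> bool" where
  "prob_diameter_approx c A \<longleftrightarrow>
     (\<forall>V E. connected_ugraph V E \<longrightarrow>
        measure coins {\<omega>. \<exists>d. outputs A V E \<omega> d \<and> approximates_diameter c V E d} \<ge> 2/3)"

end

theory Submission
  imports Defs
begin

text \<open>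
  The complete bipartite graph \<open>K\<^sub>m\<^sub>,\<^sub>m\<close> has diameter 2, and deleting any one of its \<open>m\<^sup>2\<close> edges
  \<open>{a, b}\<close> raises the diameter to 3, which a \<open>(3/2 - \<epsilon>)\<close>-approximation must detect. A one-step
  operation on \<open>S\<close> reveals the deletion only if \<open>a\<close> or \<open>b\<close> is the only element of \<open>S\<close> on its side,
  so one operation tells at most \<open>2m\<close> of the \<open>m\<^sup>2\<close> modified graphs apart from \<open>K\<^sub>m\<^sub>,\<^sub>m\<close>. For each
  edge, with probability at least \<open>1/3\<close> the same coin flips give correct answers on both graphs and
  hence different runs. Taking expectations, \<open>m\<^sup>2 / 3 \<le> 2 m q\<close> if the run on \<open>K\<^sub>m\<^sub>,\<^sub>m\<close> never uses
  more than \<open>q\<close> operations.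
\<close>

section \<open>Runs on similar graphs\<close>

text \<open>While the transcript for \<open>F i\<close> equals that for \<open>E\<close>, the next
  action is the same on both graphs, so it can split them only through a differing answer. Hence
  each operation of the run on \<open>E\<close> splits off at most \<open>w\<close> indices; a coin
  flip shows the same bit in both runs and splits off none.\<close>

lemma card_distinguished_le:
  assumes "finite I"
    and pre: "\<And>S. card {i \<in> I. pre_op V (F i) S \<noteq> pre_op V E S} \<le> w"
    and post: "\<And>S. card {i \<in> I. post_op V (F i) S \<noteq> post_op V E S} \<le> w"
  shows "card {i \<in> I. transcript A V (F i) \<omega> k \<noteq> transcript A V E \<omega> k}
           \<le> w * length (filter is_Result (transcript A V E \<omega> k))"
proof (induction k)
  case 0
  then show ?case by simp
next
  case (Suc k)
  let ?h = "transcript A V E \<omega> k"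
  let ?D = "\<lambda>k. {i \<in> I. transcript A V (F i) \<omega> k \<noteq> transcript A V E \<omega> k}"
  \<comment> \<open>\<open>X\<close> collects the indices on which the current action is answered
    differently; it is empty for outputs and coin flips.\<close>
  have step: "card (?D (Suc k)) \<le> card (?D k) + card X"
    if "?D (Suc k) \<subseteq> ?D k \<union> X" "X \<subseteq> I" for X
  proof -
    have "finite (?D k \<union> X)"
      using \<open>finite I\<close> that(2) by (auto intro: finite_subset)
    with that(1) show ?thesis
      by (meson card_Un_le card_mono le_trans)
  qed
  show ?case
  proof (cases "A V ?h")
    case (Output d)
    then show ?thesis using Suc step[of "{}"] by (force simp: Let_def)
  next
    case (Pre S)
    then show ?thesis
      using Suc pre[of S] step[of "{i \<in> I. pre_op V (F i) S \<noteq> pre_op V E S}"]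
      by (force simp: Let_def)
  next
    case (Post S)
    then show ?thesis
      using Suc post[of S] step[of "{i \<in> I. post_op V (F i) S \<noteq> post_op V E S}"]
      by (force simp: Let_def)
  next
    case Coin
    then show ?thesis using Suc step[of "{}"] by (force simp: Let_def)
  qed
qed

text \<open>The transcript freezes at an output. This allows runs that stop at different times to be
  compared at one common time.\<close>

lemma outputs_eventually:
  assumes "outputs A V E \<omega> d"
  shows "\<forall>\<^sub>F k in sequentially. A V (transcript A V E \<omega> k) = Output d"
proof -
  obtain k where k: "A V (transcript A V E \<omega> k) = Output d"
    using assms by (auto simp: outputs_def)
  have "A V (transcript A V E \<omega> l) = Output d" if "k \<le> l" for l
    using that by (induction l rule: dec_induct) (simp_all add: k Let_def)
  then show ?thesis
    by (auto simp: eventually_sequentially)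
qed

lemma card_different_outputs_le:
  assumes "finite I"
    and "\<And>S. card {i \<in> I. pre_op V (F i) S \<noteq> pre_op V E S} \<le> w"
    and "\<And>S. card {i \<in> I. post_op V (F i) S \<noteq> post_op V E S} \<le> w"
    and ops: "num_ops A V E \<omega> \<le> enat q"
  shows "card {i \<in> I. \<exists>d d'. outputs A V E \<omega> d \<and> outputs A V (F i) \<omega> d' \<and> d \<noteq> d'} \<le> w * q"
    (is "card ?J \<le> _")
proof -
  have "finite ?J"
    using \<open>finite I\<close> by simp
  have "\<forall>\<^sub>F k in sequentially. transcript A V (F i) \<omega> k \<noteq> transcript A V E \<omega> k" if i: "i \<in> ?J" for i
  proof -
    obtain d d' where "outputs A V E \<omega> d" "outputs A V (F i) \<omega> d'" "d \<noteq> d'"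
      using i by blast
    \<comment> \<open>Once both runs have stopped, equal transcripts would give
      \<open>d = d'\<close>.\<close>
    with outputs_eventually[of A V E \<omega> d] outputs_eventually[of A V "F i" \<omega> d'] show ?thesis
      by (auto elim: eventually_elim2)
  qed
  \<comment> \<open>Since \<open>?J\<close> is finite, one time \<open>k\<close> serves all its
    indices.\<close>
  then have "\<forall>\<^sub>F k in sequentially. \<forall>i\<in>?J. transcript A V (F i) \<omega> k \<noteq> transcript A V E \<omega> k"
    by (intro eventually_ball_finite[OF \<open>finite ?J\<close>] ballI)
  then obtain k where k: "\<forall>i\<in>?J. transcript A V (F i) \<omega> k \<noteq> transcript A V E \<omega> k"
    by (auto simp: eventually_sequentially)
  have "card ?J \<le> card {i \<in> I. transcript A V (F i) \<omega> k \<noteq> transcript A V E \<omega> k}"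
    using \<open>finite I\<close> k by (intro card_mono) auto
  also have "\<dots> \<le> w * length (filter is_Result (transcript A V E \<omega> k))"
    using assms by (intro card_distinguished_le)
  also have "length (filter is_Result (transcript A V E \<omega> k)) \<le> q"
    using ops by (simp add: num_ops_def SUP_le_iff)
  finally show ?thesis by simp
qed

section \<open>Coin flips and expectations\<close>

lemma prob_space_coins: "prob_space coins"
  unfolding coins_def by (intro prob_space_PiM prob_space_measure_pmf)

lemma space_coins: "space coins = UNIV"
  by (simp add: coins_def space_PiM)

lemma det_imp_prob_diameter_approx:
  assumes "det_diameter_approx c A"
  shows "prob_diameter_approx c A"
proof -
  interpret prob_space coins by (rule prob_space_coins)
  have "{\<omega>. \<exists>d. outputs A V E \<omega> d \<and> approximates_diameter c V E d} = space coins"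
    if "connected_ugraph V E" for V E
    using assms that by (auto simp: det_diameter_approx_def space_coins)
  then show ?thesis
    by (simp add: prob_diameter_approx_def prob_space)
qed

text \<open>The sum is the expected number of events \<open>C i\<close> that occur, by linearity of
  expectation, and this number never exceeds \<open>b\<close>.\<close>

lemma (in prob_space) sum_prob_le:
  assumes "finite I" "\<And>i. i \<in> I \<Longrightarrow> C i \<in> events"
    and "\<And>x. x \<in> space M \<Longrightarrow> real (card {i \<in> I. x \<in> C i}) \<le> b"
  shows "(\<Sum>i\<in>I. prob (C i)) \<le> b"
proof -
  have "(\<Sum>i\<in>I. prob (C i)) = (\<Sum>i\<in>I. expectation (indicator (C i)))"
    using assms(2) by (intro sum.cong) auto
  also have "\<dots> = expectation (\<lambda>x. \<Sum>i\<in>I. indicator (C i) x)"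
    using assms(2) by (intro Bochner_Integration.integral_sum[symmetric])
      (auto simp: emeasure_eq_measure intro!: integrable_real_indicator)
  also have "\<dots> \<le> expectation (\<lambda>_. b)"
  proof (rule integral_mono)
    show "integrable M (\<lambda>x. \<Sum>i\<in>I. indicator (C i) x :: real)"
      using assms(2) by (intro Bochner_Integration.integrable_sum)
        (auto simp: emeasure_eq_measure intro!: integrable_real_indicator)
    show "(\<Sum>i\<in>I. indicator (C i) x) \<le> b" if "x \<in> space M" for x
      using assms(3)[OF that] \<open>finite I\<close>
      by (simp add: indicator_def sum.If_cases Int_def)
  qed simp
  also have "\<dots> = b"
    by (simp add: prob_space)
  finally show ?thesis .
qed

lemma (in prob_space) prob_Int_ge:
  assumes "A \<in> events" "B \<in> events"
  shows "prob (A \<inter> B) \<ge> prob A + prob B - 1"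
  using assms finite_measure_Union'[of A B] finite_measure_Diff'[of B A] prob_le_1[of "A \<union> B"]
  by (simp add: Int_commute)

text \<open>For each \<open>i\<close>, the coin sequences that lead to correct outputs on both
  graphs have probability at least 2/3 + 2/3 - 1 = 1/3. For a fixed coin sequence, at most
  \<open>w * q\<close> indices can have this property, since no value is correct for both
  graphs.\<close>

lemma num_ops_lower_bound:
  assumes alg: "prob_diameter_approx c A"
    and conn: "connected_ugraph V E" "\<And>i. i \<in> I \<Longrightarrow> connected_ugraph V (F i)"
    and diff: "\<And>i d. i \<in> I \<Longrightarrow> approximates_diameter c V E d \<Longrightarrow>
                 \<not> approximates_diameter c V (F i) d"
    and I: "finite I"
      "\<And>S. card {i \<in> I. pre_op V (F i) S \<noteq> pre_op V E S} \<le> w"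
      "\<And>S. card {i \<in> I. post_op V (F i) S \<noteq> post_op V E S} \<le> w"
    and ops: "worst_case_ops A V E \<le> enat q"
  shows "real (card I) / 3 \<le> real (w * q)"
proof -
  interpret prob_space coins by (rule prob_space_coins)
  define R where "R = (\<lambda>E. {\<omega>. \<exists>d. outputs A V E \<omega> d \<and> approximates_diameter c V E d})"
  have prob: "prob (R E) \<ge> 2/3" if "connected_ugraph V E" for E
    using alg that by (simp add: prob_diameter_approx_def R_def)
  \<comment> \<open>Sets that are not measurable have measure 0.\<close>
  then have events: "R E \<in> events" if "connected_ugraph V E" for E
    using that measure_notin_sets[of "R E" coins] by force
  have "real (card I) / 3 = (\<Sum>i\<in>I. 1/3)"
    by simp
  also have "\<dots> \<le> (\<Sum>i\<in>I. prob (R E \<inter> R (F i)))"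
  proof (rule sum_mono)
    fix i assume "i \<in> I"
    then show "1/3 \<le> prob (R E \<inter> R (F i))"
      using prob_Int_ge[OF events events, of E "F i"] prob[of E] prob[of "F i"] conn by simp
  qed
  also have "\<dots> \<le> real (w * q)"
  proof (rule sum_prob_le)
    show "R E \<inter> R (F i) \<in> events" if "i \<in> I" for i
      using that events conn by blast
    fix \<omega>
    have "num_ops A V E \<omega> \<le> enat q"
      using ops by (simp add: worst_case_ops_def SUP_le_iff)
    then have "card {i \<in> I. \<exists>d d'. outputs A V E \<omega> d \<and> outputs A V (F i) \<omega> d' \<and> d \<noteq> d'} \<le> w * q"
      using I by (intro card_different_outputs_le)
    moreover have "card {i \<in> I. \<omega> \<in> R E \<inter> R (F i)}
        \<le> card {i \<in> I. \<exists>d d'. outputs A V E \<omega> d \<and> outputs A V (F i) \<omega> d' \<and> d \<noteq> d'}"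
    proof (rule card_mono)
      show "{i \<in> I. \<omega> \<in> R E \<inter> R (F i)}
          \<subseteq> {i \<in> I. \<exists>d d'. outputs A V E \<omega> d \<and> outputs A V (F i) \<omega> d' \<and> d \<noteq> d'}"
        unfolding R_def using diff by blast
    qed (use \<open>finite I\<close> in simp)
    ultimately show "real (card {i \<in> I. \<omega> \<in> R E \<inter> R (F i)}) \<le> real (w * q)"
      using of_nat_mono le_trans by blast
  qed (use \<open>finite I\<close> in auto)
  finally show ?thesis .
qed

section \<open>Complete bipartite graphs\<close>

lemma gdist_le_gdiameter:
  assumes "finite V" "u \<in> V" "v \<in> V" "(u, v) \<in> E\<^sup>*"
  shows "gdist E u v \<le> gdiameter V E"
proof -
  have "finite {gdist E u v |u v. u \<in> V \<and> v \<in> V \<and> (u, v) \<in> E\<^sup>*}"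
    by (rule finite_subset[of _ "(\<lambda>(u, v). gdist E u v) ` (V \<times> V)"]) (use \<open>finite V\<close> in auto)
  with assms show ?thesis
    unfolding gdiameter_def by (intro Max_ge) auto
qed

lemma gdiameter_le:
  assumes "finite V" "V \<noteq> {}" "\<And>u v. u \<in> V \<Longrightarrow> v \<in> V \<Longrightarrow> gdist E u v \<le> k"
  shows "gdiameter V E \<le> k"
proof -
  have "finite {gdist E u v |u v. u \<in> V \<and> v \<in> V \<and> (u, v) \<in> E\<^sup>*}"
    by (rule finite_subset[of _ "(\<lambda>(u, v). gdist E u v) ` (V \<times> V)"]) (use \<open>finite V\<close> in auto)
  moreover have "{gdist E u v |u v. u \<in> V \<and> v \<in> V \<and> (u, v) \<in> E\<^sup>*} \<noteq> {}"
    using \<open>V \<noteq> {}\<close> by blast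
  ultimately show ?thesis
    unfolding gdiameter_def using assms(3) by (subst Max_le_iff) auto
qed

lemma connected_ugraph_via:
  assumes "finite V" "z \<in> V" "E \<subseteq> V \<times> V" "sym E" "irrefl E" "\<And>v. v \<in> V \<Longrightarrow> (v, z) \<in> E\<^sup>*"
  shows "connected_ugraph V E"
proof -
  have "(u, v) \<in> E\<^sup>*" if "u \<in> V" "v \<in> V" for u v
    using assms(6)[OF that(1)] assms(6)[OF that(2)] sym_rtrancl[OF \<open>sym E\<close>]
    by (meson rtrancl_trans symD)
  with assms show ?thesis
    by (auto simp: connected_ugraph_def)
qed

section \<open>Edge deletion seen through one-step operations\<close>

lemma post_op_sym: "sym E \<Longrightarrow> post_op V E = pre_op V E"
  unfolding pre_op_def post_op_def by (intro ext) (auto dest: symD)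

definition complete_bipartite :: "nat set \<Rightarrow> nat set \<Rightarrow> nat rel" where
  "complete_bipartite A B = A \<times> B \<union> B \<times> A"

definition delete_edge :: "nat rel \<Rightarrow> nat \<times> nat \<Rightarrow> nat rel" where
  "delete_edge E e = E - {e, prod.swap e}"

lemma sym_complete_bipartite: "sym (complete_bipartite A B)"
  by (auto simp: complete_bipartite_def sym_def)

lemma sym_delete_edge: "sym E \<Longrightarrow> sym (delete_edge E e)"
  by (cases e) (auto simp: delete_edge_def sym_def)

lemma card_pre_op_delete_edge_le:
  assumes "finite A" "finite B" "A \<inter> B = {}"
  shows "card {e \<in> A \<times> B. pre_op V (delete_edge (complete_bipartite A B) e) S
           \<noteq> pre_op V (complete_bipartite A B) S} \<le> card A + card B"
    (is "card ?X \<le> _")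
proof -
  \<comment> \<open>If \<open>S \<inter> A\<close> is not a singleton, \<open>the_elem\<close> is
    some unspecified vertex. This is harmless: \<open>?Y\<close> and \<open>?Z\<close> only have to
    cover the affected edges, and their sizes are at most \<open>card B\<close> and
    \<open>card A\<close> in any case.\<close>
  let ?Y = "{the_elem (S \<inter> A)} \<times> B" and ?Z = "A \<times> {the_elem (S \<inter> B)}"
  let ?K = "complete_bipartite A B"
  have "?X \<subseteq> ?Y \<union> ?Z"
  proof -
    have "(\<exists>s\<in>S. (v, s) \<in> delete_edge ?K (a, b)) \<longleftrightarrow> (\<exists>s\<in>S. (v, s) \<in> ?K)"
      if ab: "a \<in> A" "b \<in> B" "(a, b) \<notin> ?Y \<union> ?Z" for a b v
    proof
      assume "\<exists>s\<in>S. (v, s) \<in> ?K"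
      then obtain s where s: "s \<in> S" "(v, s) \<in> ?K" by blast
      consider "(v, s) \<in> delete_edge ?K (a, b)" | "v = a" "s = b" | "v = b" "s = a"
        using s(2) by (auto simp: delete_edge_def)
      then show "\<exists>s\<in>S. (v, s) \<in> delete_edge ?K (a, b)"
      proof cases
        case 1
        with s(1) show ?thesis by blast
      next
        case 2
        \<comment> \<open>Otherwise \<open>b = the_elem (S \<inter> B)\<close>, so
          \<open>(a, b)\<close> would lie in \<open>?Z\<close>. Thus \<open>S\<close> contains
          another neighbour \<open>b'\<close> of \<open>a\<close>, and \<open>a\<close> stays in the
          result.\<close>
        have "S \<inter> B \<noteq> {b}"
          using ab by auto
        with 2 s(1) ab(2) obtain b' where "b' \<in> S" "b' \<in> B" "b' \<noteq> b"
          by auto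
        with 2 ab(1,2) \<open>A \<inter> B = {}\<close> have "(v, b') \<in> delete_edge ?K (a, b)"
          by (auto simp: delete_edge_def complete_bipartite_def)
        with \<open>b' \<in> S\<close> show ?thesis by blast
      next
        case 3
        have "S \<inter> A \<noteq> {a}"
          using ab by auto
        with 3 s(1) ab(1) obtain a' where "a' \<in> S" "a' \<in> A" "a' \<noteq> a"
          by auto
        with 3 ab(1,2) \<open>A \<inter> B = {}\<close> have "(v, a') \<in> delete_edge ?K (a, b)"
          by (auto simp: delete_edge_def complete_bipartite_def)
        with \<open>a' \<in> S\<close> show ?thesis by blast
      qed
    qed (auto simp: delete_edge_def)
    then have "pre_op V (delete_edge ?K e) S = pre_op V ?K S" if "e \<in> A \<times> B" "e \<notin> ?Y \<union> ?Z" for e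
      using that by (cases e) (simp add: pre_op_def)
    then show ?thesis by blast
  qed
  then have "card ?X \<le> card (?Y \<union> ?Z)"
    using assms by (intro card_mono) auto
  also have "\<dots> \<le> card ?Y + card ?Z"
    by (rule card_Un_le)
  finally show ?thesis
    by (simp add: card_cartesian_product)
qed

section \<open>Connectivity and diameter before and after the deletion\<close>

lemma connected_complete_bipartite:
  assumes "finite A" "finite B" "A \<inter> B = {}" "a \<in> A" "b \<in> B"
  shows "connected_ugraph (A \<union> B) (complete_bipartite A B)"
proof (rule connected_ugraph_via[where z = a])
  fix v assume "v \<in> A \<union> B"
  then have "(v, a) \<in> complete_bipartite A B
      \<or> (v, b) \<in> complete_bipartite A B \<and> (b, a) \<in> complete_bipartite A B"
    using assms by (auto simp: complete_bipartite_def)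
  then show "(v, a) \<in> (complete_bipartite A B)\<^sup>*"
    by (meson r_into_rtrancl rtrancl_trans)
qed (use assms sym_complete_bipartite in \<open>auto simp: complete_bipartite_def irrefl_def\<close>)

lemma connected_delete_edge_complete_bipartite:
  assumes "finite A" "finite B" "A \<inter> B = {}"
    and "a \<in> A" "b \<in> B" "a' \<in> A" "b' \<in> B" "a \<noteq> a'" "b \<noteq> b'"
  shows "connected_ugraph (A \<union> B) (delete_edge (complete_bipartite A B) (a, b))"
    (is "connected_ugraph _ ?E")
proof (rule connected_ugraph_via[where z = a'])
  fix v assume "v \<in> A \<union> B"
  \<comment> \<open>Vertices of \<open>B\<close> keep their edge to \<open>a'\<close>, vertices of
    \<open>A\<close> other than \<open>a\<close> go through \<open>b\<close>, and \<open>a\<close>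
    itself goes through \<open>b'\<close>.\<close>
  then have "(v, a') \<in> ?E \<or> (v, b) \<in> ?E \<and> (b, a') \<in> ?E \<or> (v, b') \<in> ?E \<and> (b', a') \<in> ?E"
    using assms by (auto simp: complete_bipartite_def delete_edge_def)
  then show "(v, a') \<in> ?E\<^sup>*"
    by (meson r_into_rtrancl rtrancl_trans)
qed (use assms sym_delete_edge[OF sym_complete_bipartite] in
     \<open>auto simp: complete_bipartite_def delete_edge_def irrefl_def\<close>)

lemma gdiameter_complete_bipartite_le:
  assumes "finite A" "finite B" "a \<in> A" "b \<in> B"
  shows "gdiameter (A \<union> B) (complete_bipartite A B) \<le> 2"
proof (rule gdiameter_le)
  let ?E = "complete_bipartite A B"
  fix u v assume "u \<in> A \<union> B" "v \<in> A \<union> B"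
  \<comment> \<open>Two vertices on the same side share the neighbour \<open>a\<close> or
    \<open>b\<close>. For \<open>u = v\<close> the closed walk of length 2 suffices for an upper
    bound.\<close>
  then have "(u, v) \<in> ?E \<or> (u, a) \<in> ?E \<and> (a, v) \<in> ?E \<or> (u, b) \<in> ?E \<and> (b, v) \<in> ?E"
    using assms by (auto simp: complete_bipartite_def)
  then have "(u, v) \<in> ?E ^^ 1 \<or> (u, v) \<in> ?E ^^ 2"
    by (auto simp: numeral_2_eq_2)
  then show "gdist ?E u v \<le> 2"
    unfolding gdist_def by (metis Least_le le_trans one_le_numeral order_refl)
qed (use assms in auto)

lemma gdiameter_delete_edge_complete_bipartite_ge:
  assumes "finite A" "finite B" "A \<inter> B = {}"
    and "a \<in> A" "b \<in> B" "a' \<in> A" "b' \<in> B" "a \<noteq> a'" "b \<noteq> b'"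
  shows "gdiameter (A \<union> B) (delete_edge (complete_bipartite A B) (a, b)) \<ge> 3"
    (is "gdiameter _ ?E \<ge> _")
proof -
  have conn: "(a, b) \<in> ?E\<^sup>*"
    using connected_delete_edge_complete_bipartite[OF assms] assms(4,5)
    by (auto simp: connected_ugraph_def)
  then obtain k where "(a, b) \<in> ?E ^^ k"
    using rtrancl_imp_relpow by blast
  \<comment> \<open>The least walk length is attained only because some walk exists, hence the
    appeal to connectivity.\<close>
  then have dist: "(a, b) \<in> ?E ^^ gdist ?E a b"
    unfolding gdist_def by (rule LeastI)
  \<comment> \<open>The ends differ, their edge is deleted, and a walk of length 2 returns to its
    own side.\<close>
  have "(a, b) \<notin> ?E ^^ 0" "(a, b) \<notin> ?E ^^ 1" "(a, b) \<notin> ?E ^^ 2"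
    using assms(3-5) by (auto simp: numeral_2_eq_2 delete_edge_def complete_bipartite_def)
  with dist have "gdist ?E a b \<noteq> 0" "gdist ?E a b \<noteq> 1" "gdist ?E a b \<noteq> 2"
    by metis+
  then have "3 \<le> gdist ?E a b"
    by linarith
  also have "\<dots> \<le> gdiameter (A \<union> B) ?E"
    using assms conn by (intro gdist_le_gdiameter) auto
  finally show ?thesis .
qed

text \<open>Estimates for \<open>E\<close> are at most 2, those for \<open>E'\<close> at least
  \<open>3 / c\<close>, and \<open>3 / c > 2\<close> exactly because \<open>c < 3/2\<close>.\<close>

lemma approximates_diameter_gap:
  assumes "1 \<le> c" "c < 3/2" "gdiameter V E \<le> 2" "3 \<le> gdiameter V E'"
    and "approximates_diameter c V E d"
  shows "\<not> approximates_diameter c V E' d"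
proof -
  have "d \<le> 2"
    using assms(3,5) by (simp add: approximates_diameter_def)
  also have "2 < 3 / c"
    using assms(1,2) by (simp add: field_simps)
  also have "\<dots> \<le> real (gdiameter V E') / c"
    using assms(1,4) by (intro divide_right_mono) auto
  finally show ?thesis
    by (simp add: approximates_diameter_def)
qed

section \<open>The linear lower bound\<close>

lemma worst_case_ops_complete_bipartite:
  assumes c: "1 \<le> c" "c < 3/2" and alg: "prob_diameter_approx c Alg"
    and AB: "finite A" "finite B" "A \<inter> B = {}" "card A = m" "card B = m" and "2 \<le> m"
    and ops: "worst_case_ops Alg (A \<union> B) (complete_bipartite A B) \<le> enat q"
  shows "real m \<le> 6 * real q"
proof -
  let ?E = "complete_bipartite A B"
  \<comment> \<open>Each side needs a vertex besides the end of the deleted edge, to keep the graph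
    connected.\<close>
  have other: "\<exists>y\<in>X. x \<noteq> y" if "card X = m" for X :: "nat set" and x
  proof (rule ccontr)
    assume "\<not> ?thesis"
    then have "X \<subseteq> {x}" by auto
    then have "card X \<le> 1" using card_mono[of "{x}" X] by simp
    with that \<open>2 \<le> m\<close> show False by simp
  qed
  obtain a b where ab: "a \<in> A" "b \<in> B"
    using AB \<open>2 \<le> m\<close> by fastforce
  have del: "connected_ugraph (A \<union> B) (delete_edge ?E e)"
    "3 \<le> gdiameter (A \<union> B) (delete_edge ?E e)" if e: "e \<in> A \<times> B" for e
  proof -
    obtain a' b' where "a' \<in> A" "fst e \<noteq> a'" "b' \<in> B" "snd e \<noteq> b'"
      using other AB by metis
    with e AB show "connected_ugraph (A \<union> B) (delete_edge ?E e)"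
      "3 \<le> gdiameter (A \<union> B) (delete_edge ?E e)"
      using connected_delete_edge_complete_bipartite[of A B "fst e" "snd e" a' b']
        gdiameter_delete_edge_complete_bipartite_ge[of A B "fst e" "snd e" a' b']
      by (simp_all add: mem_Times_iff)
  qed
  have pre: "card {e \<in> A \<times> B. pre_op V (delete_edge ?E e) S \<noteq> pre_op V ?E S} \<le> 2 * m" for V S
    using card_pre_op_delete_edge_le[OF AB(1-3), of V S] AB(4,5) by simp
  have "real (card (A \<times> B)) / 3 \<le> real (2 * m * q)"
  proof (rule num_ops_lower_bound[OF alg _ del(1) _ _ pre _ ops])
    show "connected_ugraph (A \<union> B) ?E"
      using AB ab by (intro connected_complete_bipartite)
    show "\<not> approximates_diameter c (A \<union> B) (delete_edge ?E e) d"
      if "e \<in> A \<times> B" "approximates_diameter c (A \<union> B) ?E d" for e d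
      using approximates_diameter_gap[OF c _ del(2)[OF that(1)] that(2)]
        gdiameter_complete_bipartite_le[OF AB(1,2) ab] by simp
    show "card {e \<in> A \<times> B. post_op (A \<union> B) (delete_edge ?E e) S \<noteq> post_op (A \<union> B) ?E S} \<le> 2 * m"
      for S
      using pre[of "A \<union> B" S] by (simp add: post_op_sym sym_delete_edge sym_complete_bipartite)
  qed (use AB in auto)
  then have "real m * real m \<le> real m * (6 * real q)"
    using AB by (simp add: card_cartesian_product field_simps)
  then show ?thesis
    using \<open>2 \<le> m\<close> by (simp add: mult_le_cancel_left)
qed

theorem theorem3p15:
  fixes \<epsilon> :: real
  assumes "\<epsilon> > 0" and "3/2 - \<epsilon> \<ge> 1"
  shows "\<exists>c'::real. c' > 0 \<and>
    (\<forall>A. det_diameter_approx (3/2 - \<epsilon>) A \<or> prob_diameter_approx (3/2 - \<epsilon>) A \<longrightarrow>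
      (\<forall>N. \<exists>V E. connected_ugraph V E \<and> card V \<ge> N \<and>
         ereal (c' * real (card V)) \<le> ereal_of_enat (worst_case_ops A V E)))"
\<comment> \<open>The graph has \<open>2 * m\<close> vertices and \<open>m \<le> 6 * q\<close>, so
  \<open>q\<close> is at least a twelfth of their number.\<close>
proof (intro exI[of _ "1/12"] conjI allI impI)
  fix A and N :: nat
  assume "det_diameter_approx (3/2 - \<epsilon>) A \<or> prob_diameter_approx (3/2 - \<epsilon>) A"
  then have alg: "prob_diameter_approx (3/2 - \<epsilon>) A"
    using det_imp_prob_diameter_approx by blast
  define m :: nat where "m = max N 2"
  let ?L = "{..<m}" and ?R = "{m..<2*m}"
  let ?E = "complete_bipartite ?L ?R"
  have "connected_ugraph (?L \<union> ?R) ?E"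
    by (rule connected_complete_bipartite[of _ _ 0 m]) (auto simp: m_def)
  moreover have card: "card (?L \<union> ?R) = 2 * m"
    by (subst card_Un_disjoint) auto
  moreover have "N \<le> 2 * m"
    by (simp add: m_def)
  moreover have "ereal (1/12 * real (2 * m)) \<le> ereal_of_enat (worst_case_ops A (?L \<union> ?R) ?E)"
  proof (cases "worst_case_ops A (?L \<union> ?R) ?E")
    case (enat q)
    have "real m \<le> 6 * real q"
      by (rule worst_case_ops_complete_bipartite[OF _ _ alg, of ?L ?R])
        (use assms enat in \<open>auto simp: m_def\<close>)
    with enat show ?thesis by simp
  qed simp
  ultimately show "\<exists>V E. connected_ugraph V E \<and> N \<le> card V \<and>
      ereal (1/12 * real (card V)) \<le> ereal_of_enat (worst_case_ops A V E)"
    by metis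
qed simp

end
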